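(* For every integer $v\geq 4$, $t(T_v)=v-2$. Moreover, $S$ is a disconnecting set of vertices of $T_v$ such that $\frac{|S|}{c(T_v\setminus S)}=v-2$ if and only if $S$ is the neighborhood of a vertex of $T_v$, or $v$ is even and $S$ is the complement of a maximum independent set (of size $\frac{v}{2}$) of $T_v$.
   Context: All graphs are finite, simple and undirected. The Triangular graph $T_v$ is the line graph of the complete graph $K_v$; equivalently, its vertices are the $2$-subsets of $\{1,\dots,v\}$, two of them being adjacent if and only if they share exactly one element. For a connected graph $G$ and a vertex subset $S$, $c(G\setminus S)$ denotes the number of connected components of the graph obtained from $G$ by removing the vertices of $S$; $S$ is called disconnecting if $c(G\setminus S)\ge 2$. The toughness of $G$ is $t(G)=\min_S \frac{|S|}{c(G\setminus S)}$, the minimum being over all disconnecting vertex sets $S$. The neighborhood of a vertex is the set of vertices adjacent to it. *)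

theory Defs
  imports Complex_Main
begin

text \<open>Edges are unordered pairs, i.e. two-element sets of vertices.\<close>

record 'a graph =
  verts :: "'a set"
  edges :: "'a set set"

definition simple_graph :: "'a graph \<Rightarrow> bool" where
  "simple_graph G \<longleftrightarrow> finite (verts G) \<and> (\<forall>e\<in>edges G. e \<subseteq> verts G \<and> card e = 2)"

definition adjacent :: "'a graph \<Rightarrow> 'a \<Rightarrow> 'a \<Rightarrow> bool" where
  "adjacent G x y \<longleftrightarrow> {x, y} \<in> edges G"

definition neighborhood :: "'a graph \<Rightarrow> 'a \<Rightarrow> 'a set" where
  "neighborhood G x = {y \<in> verts G. adjacent G x y}"

definition complete_graph :: "nat \<Rightarrow> nat graph" where
  "complete_graph n = \<lparr>verts = {1..n}, edges = {e. e \<subseteq> {1..n} \<and> card e = 2}\<rparr>"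

definition line_graph :: "'a graph \<Rightarrow> 'a set graph" where
  "line_graph G = \<lparr>verts = edges G,
     edges = {{e, f} | e f. e \<in> edges G \<and> f \<in> edges G \<and> e \<noteq> f \<and> e \<inter> f \<noteq> {}}\<rparr>"

definition triangular_graph :: "nat \<Rightarrow> nat set graph" where
  "triangular_graph v = line_graph (complete_graph v)"

definition remove_verts :: "'a graph \<Rightarrow> 'a set \<Rightarrow> 'a graph" where
  "remove_verts G S = \<lparr>verts = verts G - S, edges = {e \<in> edges G. e \<inter> S = {}}\<rparr>"

definition components :: "'a graph \<Rightarrow> 'a set set" where
  "components G = {{y \<in> verts G. (adjacent G)\<^sup>*\<^sup>* x y} | x. x \<in> verts G}"

definition connected_graph :: "'a graph \<Rightarrow> bool" where
  "connected_graph G \<longleftrightarrow> verts G \<noteq> {} \<and> (\<forall>x\<in>verts G. \<forall>y\<in>verts G. (adjacent G)\<^sup>*\<^sup>* x y)"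

definition disconnecting :: "'a graph \<Rightarrow> 'a set \<Rightarrow> bool" where
  "disconnecting G S \<longleftrightarrow> S \<subseteq> verts G \<and> card (components (remove_verts G S)) \<ge> 2"

definition toughness_ratio :: "'a graph \<Rightarrow> 'a set \<Rightarrow> real" where
  "toughness_ratio G S = real (card S) / real (card (components (remove_verts G S)))"

text \<open>Only meaningful for a connected simple graph with at least one disconnecting set
  (i.e. a non-complete one), so that the minimum is over a finite nonempty set.\<close>

definition toughness :: "'a graph \<Rightarrow> real" where
  "toughness G = Min {toughness_ratio G S | S. disconnecting G S}"

definition independent_set :: "'a graph \<Rightarrow> 'a set \<Rightarrow> bool" where
  "independent_set G I \<longleftrightarrow> I \<subseteq> verts G \<and> (\<forall>x\<in>I. \<forall>y\<in>I. \<not> adjacent G x y)"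

definition maximum_independent_set :: "'a graph \<Rightarrow> 'a set \<Rightarrow> bool" where
  "maximum_independent_set G I \<longleftrightarrow>
     independent_set G I \<and> (\<forall>J. independent_set G J \<longrightarrow> card J \<le> card I)"

lemma adjacent_line_graph:
  "adjacent (line_graph G) e f \<longleftrightarrow> e \<in> edges G \<and> f \<in> edges G \<and> e \<noteq> f \<and> e \<inter> f \<noteq> {}"
proof
  assume "adjacent (line_graph G) e f"
  then obtain e' f' where *: "{e, f} = {e', f'}" "e' \<in> edges G" "f' \<in> edges G" "e' \<noteq> f'"
      "e' \<inter> f' \<noteq> {}"
    by (auto simp only: adjacent_def line_graph_def graph.simps mem_Collect_eq)
  from *(1) consider "e = e'" "f = f'" | "e = f'" "f = e'"
    by (metis doubleton_eq_iff)
  then show "e \<in> edges G \<and> f \<in> edges G \<and> e \<noteq> f \<and> e \<inter> f \<noteq> {}"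
    using *(2-) by cases (simp_all add: Int_commute)
next
  assume "e \<in> edges G \<and> f \<in> edges G \<and> e \<noteq> f \<and> e \<inter> f \<noteq> {}"
  then show "adjacent (line_graph G) e f"
    unfolding adjacent_def line_graph_def graph.simps by blast
qed

lemma verts_triangular_graph:
  "verts (triangular_graph v) = {e. e \<subseteq> {1..v} \<and> card e = 2}"
  by (simp add: triangular_graph_def line_graph_def complete_graph_def)

lemma adjacent_triangular_graph:
  assumes "e \<in> verts (triangular_graph v)" "f \<in> verts (triangular_graph v)"
  shows "adjacent (triangular_graph v) e f \<longleftrightarrow> card (e \<inter> f) = 1"
proof -
  have ef: "e \<subseteq> {1..v}" "card e = 2" "f \<subseteq> {1..v}" "card f = 2"
    using assms by (auto simp: verts_triangular_graph)
  then have fin: "finite e" "finite f"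
    by (auto intro: finite_subset)
  have "adjacent (triangular_graph v) e f \<longleftrightarrow> e \<noteq> f \<and> e \<inter> f \<noteq> {}"
    using ef by (simp add: triangular_graph_def adjacent_line_graph complete_graph_def)
  also have "\<dots> \<longleftrightarrow> card (e \<inter> f) = 1"
  proof
    assume a: "e \<noteq> f \<and> e \<inter> f \<noteq> {}"
    have "card (e \<inter> f) \<le> 2" using fin ef by (metis Int_lower1 card_mono)
    moreover have "card (e \<inter> f) \<noteq> 0" using a fin by simp
    moreover have "card (e \<inter> f) \<noteq> 2"
      using a fin ef by (metis Int_lower1 Int_lower2 card_subset_eq)
    ultimately show "card (e \<inter> f) = 1" by linarith
  qed (use ef in auto)
  finally show ?thesis .
qed

lemma simple_graph_triangular_graph: "simple_graph (triangular_graph v)"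
proof -
  have "finite {e. e \<subseteq> {1..v} \<and> card e = 2}"
    by (rule finite_subset[of _ "Pow {1..v}"]) auto
  moreover have "e \<subseteq> verts (triangular_graph v) \<and> card e = 2"
    if "e \<in> edges (triangular_graph v)" for e
    using that unfolding triangular_graph_def line_graph_def graph.simps
    by (auto simp only: card_2_iff)
  ultimately show ?thesis
    by (simp add: simple_graph_def verts_triangular_graph)
qed

lemma connected_graph_triangular_graph:
  assumes "v \<ge> 2"
  shows "connected_graph (triangular_graph v)"
proof -
  let ?G = "triangular_graph v"
  have "{1, 2} \<in> verts ?G" using assms by (auto simp: verts_triangular_graph)
  moreover have "(adjacent ?G)\<^sup>*\<^sup>* e f" if e: "e \<in> verts ?G" and f: "f \<in> verts ?G" for e f
  proof -
    have meet: "(adjacent ?G)\<^sup>*\<^sup>* e f"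
      if "e \<in> verts ?G" "f \<in> verts ?G" "e \<inter> f \<noteq> {}" for e f
    proof (cases "e = f")
      case False
      then have "adjacent ?G e f"
        using that unfolding verts_triangular_graph
        by (simp add: triangular_graph_def adjacent_line_graph complete_graph_def)
      then show ?thesis by (rule r_into_rtranclp)
    qed simp
    obtain a b where ab: "e = {a, b}" using e by (auto simp: verts_triangular_graph card_2_iff)
    obtain c d where cd: "f = {c, d}" using f by (auto simp: verts_triangular_graph card_2_iff)
    show ?thesis
    proof (cases "e \<inter> f = {}")
      case True
      then have "{a, c} \<in> verts ?G" using e f ab cd by (auto simp: verts_triangular_graph)
      then have "(adjacent ?G)\<^sup>*\<^sup>* e {a, c}" "(adjacent ?G)\<^sup>*\<^sup>* {a, c} f"
        using e f ab cd by (auto intro!: meet)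
      then show ?thesis by (rule rtranclp_trans)
    qed (use e f meet in blast)
  qed
  ultimately show ?thesis by (auto simp: connected_graph_def)
qed

end

theory Submission
  imports Defs
begin

text \<open>Let \<open>C\<close> range over the \<open>k\<close> components left after deleting \<open>S\<close>, and let \<open>a\<^sub>C\<close> be the number of
  points of \<open>K\<^sub>v\<close> covered by \<open>C\<close>. Distinct components cover disjoint sets of points, so with
  \<open>b\<^sub>C = a\<^sub>C - 2 \<ge> 0\<close> and \<open>B = v - 2k\<close> one has \<open>\<Sum> b\<^sub>C \<le> B\<close>. Then \<open>2 (\<bar>S\<bar> - k (v - 2))\<close> equals
  \<open>2 B (k - 2) + (B + 3) (B - \<Sum> b\<^sub>C) + \<Sum> b\<^sub>C (B - b\<^sub>C) + \<Sum> (a\<^sub>C (a\<^sub>C - 1) - 2 \<bar>C\<bar>)\<close>, a sum of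
  nonnegative terms. All of them vanish only if every \<open>C\<close> consists of all pairs of its points,
  the points are all covered, and either \<open>k = 2\<close> with one component a single pair, or every
  component is a single pair.\<close>

section \<open>Components\<close>

lemma rtranclp_adjacent_sym: "(adjacent G)\<^sup>*\<^sup>* x y \<Longrightarrow> (adjacent G)\<^sup>*\<^sup>* y x"
  by (rule sympD[OF symp_rtranclp]) (auto intro: sympI simp: adjacent_def insert_commute)

lemma Union_components: "\<Union>(components G) = verts G"
  unfolding components_def by auto

text \<open>Reachability is symmetric and transitive, so a path between points of two classes also
  links their representatives in both directions.\<close>

lemma components_eqD:
  assumes "C \<in> components G" "D \<in> components G" "x \<in> C" "y \<in> D" "(adjacent G)\<^sup>*\<^sup>* x y"
  shows "C = D"
proof -
  obtain c d where c: "C = {z \<in> verts G. (adjacent G)\<^sup>*\<^sup>* c z}"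
    and d: "D = {z \<in> verts G. (adjacent G)\<^sup>*\<^sup>* d z}"
    using assms(1,2) unfolding components_def by auto
  have "(adjacent G)\<^sup>*\<^sup>* c x" "(adjacent G)\<^sup>*\<^sup>* y d"
    using assms(3,4) c d rtranclp_adjacent_sym[of G d y] by auto
  then have "(adjacent G)\<^sup>*\<^sup>* c d"
    using assms(5) by (meson rtranclp_trans)
  then have "(adjacent G)\<^sup>*\<^sup>* c d" "(adjacent G)\<^sup>*\<^sup>* d c"
    by (auto intro: rtranclp_adjacent_sym)
  then show ?thesis unfolding c d by (auto intro: rtranclp_trans)
qed

text \<open>Closure under adjacency propagates along paths, so everything reachable from a point of
  a block stays in that block. Connectedness gives the converse. This serves to compute components
  explicitly for the extremal sets.\<close>

lemma components_eqI:
  assumes cover: "\<Union>P = verts G" and ne: "{} \<notin> P"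
    and conn: "\<And>C x y. C \<in> P \<Longrightarrow> x \<in> C \<Longrightarrow> y \<in> C \<Longrightarrow> (adjacent G)\<^sup>*\<^sup>* x y"
    and closed: "\<And>C x y. C \<in> P \<Longrightarrow> x \<in> C \<Longrightarrow> adjacent G x y \<Longrightarrow> y \<in> C"
  shows "components G = P"
proof -
  have cl: "y \<in> C" if "(adjacent G)\<^sup>*\<^sup>* x y" "C \<in> P" "x \<in> C" for C x y
    using that by (induction rule: rtranclp_induct) (auto intro: closed)
  have eq: "{y \<in> verts G. (adjacent G)\<^sup>*\<^sup>* x y} = C" if "C \<in> P" "x \<in> C" for C x
    using that cl conn cover by blast
  show ?thesis
  proof
    show "components G \<subseteq> P"
      using cover eq unfolding components_def by blast
    show "P \<subseteq> components G"
    proof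
      fix C assume C: "C \<in> P"
      then obtain x where x: "x \<in> C" using ne by fastforce
      then have "x \<in> verts G" using C cover by auto
      then show "C \<in> components G"
        unfolding components_def using eq[OF C x] by blast
    qed
  qed
qed

section \<open>Families of pairs with disjoint supports\<close>

definition pairs :: "'a set \<Rightarrow> 'a set set" where
  "pairs A = {e. e \<subseteq> A \<and> card e = 2}"

lemma finite_pairs: "finite A \<Longrightarrow> finite (pairs A)"
  unfolding pairs_def by (rule finite_subset[of _ "Pow A"]) auto

lemma card_pairs: "finite A \<Longrightarrow> card (pairs A) = card A choose 2"
  unfolding pairs_def by (rule n_subsets)

text \<open>Doubling and passing to the reals removes the halving and the truncated subtraction, so
  the later identities are polynomial.\<close>

lemma real_card_pairs:
  assumes "finite A"
  shows "2 * real (card (pairs A)) = real (card A) * (real (card A) - 1)"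
proof -
  have "2 * real (n choose 2) = real n * (real n - 1)" for n
    by (induction n) (simp_all add: numeral_2_eq_2 algebra_simps)
  then show ?thesis using assms by (simp add: card_pairs)
qed

lemma pairs_card2:
  assumes "card e = 2"
  shows "pairs e = {e}"
proof -
  have "finite e" using assms by (intro card_ge_0_finite) simp
  then show ?thesis using assms unfolding pairs_def by (auto dest: card_subset_eq)
qed

text \<open>The extremal problem without graphs: of the components, only the disjointness of their
  supports is kept. \<open>P\<close> plays the components and \<open>A\<close> the point set, so the
  right-hand side becomes the number of deleted vertices.\<close>

lemma disjoint_family_pairs_deficit:
  fixes P :: "'a set set set"
  assumes fA: "finite A" and fP: "finite P" and k2: "card P \<ge> 2"
    and ne: "\<And>C. C \<in> P \<Longrightarrow> C \<noteq> {}" and sub: "\<And>C. C \<in> P \<Longrightarrow> C \<subseteq> pairs A"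
    and disj: "\<And>C D. C \<in> P \<Longrightarrow> D \<in> P \<Longrightarrow> C \<noteq> D \<Longrightarrow> \<Union>C \<inter> \<Union>D = {}"
  shows "real (card P) * (real (card A) - 2) \<le> real (card (pairs A)) - real (card (\<Union>P))" (is ?ineq)
    and "real (card P) * (real (card A) - 2) = real (card (pairs A)) - real (card (\<Union>P)) \<Longrightarrow>
      (\<exists>e \<in> pairs A. P = {{e}, pairs (A - e)}) \<or>
      (card A = 2 * card P \<and> (\<forall>C\<in>P. \<exists>e. C = {e}))" (is "?eq \<Longrightarrow> ?concl")
proof -
  define b where "b C = real (card (\<Union>C)) - 2" for C :: "'a set set"
  define k where "k = real (card P)"
  define B where "B = real (card A) - 2 * k"
  \<comment> \<open>\<open>d C\<close> counts the pairs inside the support of \<open>C\<close> that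
    are missing from \<open>C\<close>.\<close>
  define d where "d C = real (card (pairs (\<Union>C))) - real (card C)" for C :: "'a set set"
  have subA: "\<Union>C \<subseteq> A" if "C \<in> P" for C
    using sub[OF that] unfolding pairs_def by auto
  have fU: "finite (\<Union>C)" if "C \<in> P" for C
    using subA[OF that] fA by (rule finite_subset)
  have subU: "C \<subseteq> pairs (\<Union>C)" if "C \<in> P" for C
    using sub[OF that] unfolding pairs_def by auto
  have fC: "finite C" if "C \<in> P" for C
    using sub[OF that] finite_pairs[OF fA] by (rule finite_subset)
  \<comment> \<open>A nonempty member contains a pair, so its support has at least two
    points.\<close>
  have b0: "b C \<ge> 0" if C: "C \<in> P" for C
  proof -
    obtain e where e: "e \<in> C" using ne[OF C] by auto
    then have "card e = 2" using sub[OF C] by (auto simp: pairs_def)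
    moreover have "card e \<le> card (\<Union>C)" using e fU[OF C] by (intro card_mono) auto
    ultimately show ?thesis by (simp add: b_def)
  qed
  have d0: "d C \<ge> 0" if C: "C \<in> P" for C
    using card_mono[OF finite_pairs[OF fU[OF C]] subU[OF C]] by (simp add: d_def)
  have "(\<Sum>C\<in>P. card (\<Union>C)) = card (\<Union>C\<in>P. \<Union>C)"
    using fP fU disj by (intro card_UN_disjoint[symmetric]) auto
  also have "\<dots> \<le> card A"
    using fA subA by (intro card_mono) auto
  finally have "(\<Sum>C\<in>P. real (card (\<Union>C))) \<le> real (card A)"
    by (metis of_nat_le_iff of_nat_sum)
  then have sb: "sum b P \<le> B"
    by (simp add: b_def B_def k_def sum_subtractf)
  have bB: "b C \<le> B" if "C \<in> P" for C
    using member_le_sum[OF that, of b] b0 fP sb by fastforce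
  have B0: "B \<ge> 0" using sb sum_nonneg[of P b] b0 by fastforce
  \<comment> \<open>A common pair would be nonempty and put its points into both supports.\<close>
  have dC: "C \<inter> D = {}" if "C \<in> P" "D \<in> P" "C \<noteq> D" for C D
  proof (rule ccontr)
    assume "C \<inter> D \<noteq> {}"
    then obtain e where e: "e \<in> C" "e \<in> D" by auto
    then have "card e = 2" using sub[OF that(1)] by (auto simp: pairs_def)
    then have "e \<noteq> {}" by auto
    then show False using e disj[OF that] by auto
  qed
  have cU: "real (card (\<Union>P)) = (\<Sum>C\<in>P. real (card C))"
    using card_UN_disjoint[OF fP, of "\<lambda>C. C"] fC dC by simp
  have d2: "2 * d C = b C * b C + 3 * b C + 2 - 2 * real (card C)" if "C \<in> P" for C
    using real_card_pairs[OF fU[OF that]] by (simp add: d_def b_def algebra_simps)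
  have sd: "2 * sum d P = (\<Sum>C\<in>P. b C * b C) + 3 * sum b P + 2 * k - 2 * real (card (\<Union>P))"
    by (simp add: sum_distrib_left d2 sum.distrib sum_subtractf k_def cU)
  have sq: "(\<Sum>C\<in>P. b C * (B - b C)) = B * sum b P - (\<Sum>C\<in>P. b C * b C)"
    by (simp add: sum_distrib_left sum_subtractf algebra_simps)
  have A: "real (card A) = B + 2 * k" by (simp add: B_def)
  \<comment> \<open>After substituting \<open>B + 2 * k\<close> for the size of \<open>A\<close>,
    the squares of \<open>b C\<close> from \<open>sd\<close> and \<open>sq\<close> cancel, and so do
    all terms in \<open>sum b P\<close>.\<close>
  have deficit: "2 * (real (card (pairs A)) - real (card (\<Union>P)) - k * (real (card A) - 2)) =
     2 * (B * (k - 2)) + (B + 3) * (B - sum b P) + (\<Sum>C\<in>P. b C * (B - b C)) + 2 * sum d P"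
    using real_card_pairs[OF fA] unfolding sd sq A by (simp add: algebra_simps)
  have kk: "k \<ge> 2" using k2 by (simp add: k_def)
  have n1: "B * (k - 2) \<ge> 0" using B0 kk by simp
  have n2: "(B + 3) * (B - sum b P) \<ge> 0" using B0 sb by simp
  have n3: "b C * (B - b C) \<ge> 0" if "C \<in> P" for C using b0[OF that] bB[OF that] by simp
  have n3': "(\<Sum>C\<in>P. b C * (B - b C)) \<ge> 0" by (intro sum_nonneg n3)
  have n4: "sum d P \<ge> 0" by (intro sum_nonneg d0)
  show ?ineq using deficit n1 n2 n3' n4 by (simp add: k_def)
  assume ?eq
  \<comment> \<open>Equality forces each of the four nonnegative terms to vanish; the facts below
    read off one consequence of each.\<close>
  then have z: "2 * (B * (k - 2)) + (B + 3) * (B - sum b P) + (\<Sum>C\<in>P. b C * (B - b C)) + 2 * sum d P = 0"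
    using deficit by (simp add: k_def)
  have z1: "B = 0 \<or> k = 2" using z n1 n2 n3' n4
    by (smt (verit) mult_eq_0_iff)
  have "(B + 3) * (B - sum b P) = 0" using z n1 n2 n3' n4 by linarith
  then have z2: "sum b P = B" using B0 by simp
  have "(\<Sum>C\<in>P. b C * (B - b C)) = 0" using z n1 n2 n3' n4 by linarith
  then have z3: "b C = 0 \<or> b C = B" if "C \<in> P" for C
    using that sum_nonneg_eq_0_iff[OF fP n3] by auto
  have "sum d P = 0" using z n1 n2 n3' n4 by linarith
  then have "d C = 0" if "C \<in> P" for C
    using that sum_nonneg_eq_0_iff[OF fP d0] by auto
  then have full: "C = pairs (\<Union>C)" if "C \<in> P" for C
    using that subU[OF that] finite_pairs[OF fU[OF that]]
    by (intro card_subset_eq) (auto simp: d_def)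
  \<comment> \<open>Zero excess means a two-point support, which carries exactly one pair.\<close>
  have single: "C = {\<Union>C}" if "C \<in> P" "b C = 0" for C
    using full[OF that(1)] pairs_card2[of "\<Union>C"] that(2) by (simp add: b_def)
  show ?concl
  proof (cases "B = 0")
    case True
    have "real (card A) = real (2 * card P)" using A True by (simp add: k_def)
    then have "card A = 2 * card P" by (simp only: of_nat_eq_iff)
    moreover have "\<exists>e. C = {e}" if "C \<in> P" for C
      using single[OF that] z3[OF that] True by blast
    ultimately show ?thesis by blast
  next
    case False
    then have "card P = 2" using z1 by (simp add: k_def)
    then obtain C' D' where P': "P = {C', D'}" "C' \<noteq> D'" by (auto simp: card_2_iff)
    \<comment> \<open>Each of the two excesses is 0 or \<open>B\<close>, and they add up to
      \<open>B\<close>, which is nonzero here. So exactly one is 0, and \<open>C\<close> names that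
      member.\<close>
    then have "b C' + b D' = B" using z2 by simp
    then obtain C D where P: "P = {C, D}" "C \<noteq> D" and b: "b C = 0" "b D = B"
      using z3[of C'] z3[of D'] P' by (cases "b C' = 0") auto
    define e where "e = \<Union>C"
    have C: "C = {e}" using single[of C] P b by (simp add: e_def)
    have eA: "e \<in> pairs A" using sub[of C] P C by auto
    have k: "k = 2" using False z1 by simp
    have "card (A - e) = card A - 2" using eA fA
      by (subst card_Diff_subset) (auto simp: pairs_def intro: finite_subset)
    moreover have "real (card (\<Union>D)) = real (card A) - 2" using b A k by (simp add: b_def)
    \<comment> \<open>Disjointness gives the inclusion; both sides have two points fewer than
      \<open>A\<close>, so they agree.\<close>
    moreover have "\<Union>D \<subseteq> A - e" using subA[of D] disj[of C D] P by (auto simp: e_def)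
    ultimately have "\<Union>D = A - e" using fA by (intro card_subset_eq) auto
    then have "D = pairs (A - e)" using full[of D] P by simp
    then have "P = {{e}, pairs (A - e)}" using P(1) C by (simp only:)
    then show ?thesis using eA by blast
  qed
qed

section \<open>Deleting vertices from a triangular graph\<close>

lemma verts_triangular_graph_pairs: "verts (triangular_graph v) = pairs {1..v}"
  by (simp add: verts_triangular_graph pairs_def)

lemma verts_remove_verts: "verts (remove_verts G S) = verts G - S"
  by (simp add: remove_verts_def)

lemma adjacent_triangular_graph_iff:
  "adjacent (triangular_graph v) e f \<longleftrightarrow>
    e \<in> pairs {1..v} \<and> f \<in> pairs {1..v} \<and> e \<noteq> f \<and> e \<inter> f \<noteq> {}"
  by (simp add: triangular_graph_def adjacent_line_graph complete_graph_def pairs_def)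

lemma adjacent_remove_verts:
  "adjacent (remove_verts G S) x y \<longleftrightarrow> adjacent G x y \<and> x \<notin> S \<and> y \<notin> S"
  by (auto simp: adjacent_def remove_verts_def)

section \<open>Independent sets as matchings of the complete graph\<close>

lemma independent_set_triangular_graph:
  "independent_set (triangular_graph v) I \<longleftrightarrow>
    I \<subseteq> pairs {1..v} \<and> (\<forall>e\<in>I. \<forall>f\<in>I. e \<noteq> f \<longrightarrow> e \<inter> f = {})"
  unfolding independent_set_def verts_triangular_graph_pairs adjacent_triangular_graph_iff
  by blast

text \<open>The members are disjoint pairs, so their union has twice as many points and lies in
  \<open>{1..v}\<close>.\<close>

lemma card_independent_set_triangular_graph:
  assumes "independent_set (triangular_graph v) I"
  shows "2 * card I \<le> v"
proof -
  have I: "I \<subseteq> pairs {1..v}" "\<And>e f. e \<in> I \<Longrightarrow> f \<in> I \<Longrightarrow> e \<noteq> f \<Longrightarrow> e \<inter> f = {}"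
    using assms unfolding independent_set_triangular_graph by auto
  have "finite I" using I(1) by (rule finite_subset) (simp add: finite_pairs)
  moreover have "finite e" if "e \<in> I" for e
    using that I(1) by (auto simp: pairs_def intro: finite_subset)
  ultimately have "card (\<Union>e\<in>I. e) = (\<Sum>e\<in>I. card e)"
    using I by (intro card_UN_disjoint) auto
  also have "\<dots> = (\<Sum>e\<in>I. 2)" using I(1) by (intro sum.cong) (auto simp: pairs_def)
  finally have "card (\<Union>I) = 2 * card I" by simp
  moreover have "card (\<Union>I) \<le> card {1..v}" using I(1) by (intro card_mono) (auto simp: pairs_def)
  ultimately show ?thesis by simp
qed

lemma ex_perfect_matching_triangular_graph:
  "\<exists>I. independent_set (triangular_graph (2 * m)) I \<and> card I = m"
proof (intro exI conjI)
  \<comment> \<open>Consecutive pairs tile \<open>{1..2 * m}\<close>; the offsets 1 and 2 account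
    for indices starting at 0 and points at 1.\<close>
  let ?f = "\<lambda>i. {2 * i + 1, 2 * i + 2 :: nat}"
  have ne: "?f i \<inter> ?f j = {}" if "i \<noteq> j" for i j
    using that by auto
  have "inj_on ?f {..<m}"
  proof (rule inj_onI, rule ccontr)
    fix i j assume "?f i = ?f j" "i \<noteq> j"
    then show False using ne[of i j] by simp
  qed
  then show "card (?f ` {..<m}) = m" by (simp add: card_image)
  have "?f i \<in> pairs {1..2 * m}" if "i < m" for i
    using that by (simp add: pairs_def)
  then have "?f ` {..<m} \<subseteq> pairs {1..2 * m}" by (intro image_subsetI) simp
  moreover have "e \<inter> f = {}" if "e \<in> ?f ` {..<m}" "f \<in> ?f ` {..<m}" "e \<noteq> f" for e f
  proof -
    obtain i j where "e = ?f i" "f = ?f j" using \<open>e \<in> _\<close> \<open>f \<in> _\<close> by (elim imageE)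
    then show ?thesis using ne[of i j] \<open>e \<noteq> f\<close> by (cases "i = j") simp_all
  qed
  ultimately show "independent_set (triangular_graph (2 * m)) (?f ` {..<m})"
    unfolding independent_set_triangular_graph by (intro conjI ballI impI)
qed

text \<open>For even \<open>v\<close> the bound \<open>v div 2\<close> is attained by a perfect
  matching, so maximality can be tested by size alone.\<close>

lemma maximum_independent_set_triangular_graph:
  assumes "even v"
  shows "maximum_independent_set (triangular_graph v) I \<longleftrightarrow>
    independent_set (triangular_graph v) I \<and> card I = v div 2"
proof -
  obtain J where J: "independent_set (triangular_graph v) J" "card J = v div 2"
    using ex_perfect_matching_triangular_graph[of "v div 2"] assms by auto
  have le: "card K \<le> v div 2" if "independent_set (triangular_graph v) K" for K
    using card_independent_set_triangular_graph[OF that] by linarith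
  show ?thesis
    unfolding maximum_independent_set_def using J le by (metis antisym)
qed

section \<open>Counting deleted and surviving pairs\<close>

lemma card_pairs_atLeastAtMost:
  fixes v :: nat
  shows "2 * real (card (pairs {1..v})) = real v * (real v - 1)"
  using real_card_pairs[of "{1..v}"] by simp

lemma card_diff_pairs:
  fixes v :: nat
  assumes "S \<subseteq> pairs {1..v}"
  shows "real (card S) = real (card (pairs {1..v})) - real (card (pairs {1..v} - S))"
proof -
  have "finite (pairs {1..v})" by (simp add: finite_pairs)
  then show ?thesis
    using assms card_Diff_subset[OF finite_subset[OF assms] assms] card_mono[OF _ assms]
    by (simp add: of_nat_diff)
qed

text \<open>A pair fails to be adjacent to \<open>e\<close> exactly when it is \<open>e\<close>
  itself or misses both points of \<open>e\<close>.\<close>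

lemma neighborhood_triangular_graph:
  assumes "e \<in> pairs {1..v}"
  shows "pairs {1..v} - neighborhood (triangular_graph v) e = insert e (pairs ({1..v} - e))"
  using assms
  by (auto simp: neighborhood_def verts_triangular_graph_pairs adjacent_triangular_graph_iff pairs_def)

section \<open>Toughness\<close>

locale triangular_disconnecting =
  fixes v :: nat and S :: "nat set set"
  assumes dis: "disconnecting (triangular_graph v) S"
begin

abbreviation "P \<equiv> components (remove_verts (triangular_graph v) S)"

lemma S_sub: "S \<subseteq> pairs {1..v}"
  using dis by (simp add: disconnecting_def verts_triangular_graph_pairs)

lemma card_P: "card P \<ge> 2"
  using dis by (simp add: disconnecting_def)

lemma Union_P: "\<Union>P = pairs {1..v} - S"
  by (simp add: Union_components verts_remove_verts verts_triangular_graph_pairs)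

text \<open>Two surviving pairs with a common point are equal or adjacent, hence in one component.
  This is where the line graph structure enters the lower bound.\<close>

lemma P_disjoint:
  assumes "C \<in> P" "D \<in> P" "C \<noteq> D"
  shows "\<Union>C \<inter> \<Union>D = {}"
proof (rule ccontr)
  assume "\<Union>C \<inter> \<Union>D \<noteq> {}"
  then obtain e f x where ef: "e \<in> C" "f \<in> D" "x \<in> e" "x \<in> f" by auto
  then have "e \<in> pairs {1..v} - S" "f \<in> pairs {1..v} - S"
    using assms Union_P by auto
  then have "e = f \<or> adjacent (remove_verts (triangular_graph v) S) e f"
    using ef by (auto simp: adjacent_remove_verts adjacent_triangular_graph_iff)
  then have "(adjacent (remove_verts (triangular_graph v) S))\<^sup>*\<^sup>* e f" by auto
  then show False using components_eqD[OF assms(1,2) ef(1,2)] assms(3) by simp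
qed

lemma P_nonempty: "C \<in> P \<Longrightarrow> C \<noteq> {}"
  by (auto simp: components_def)

lemma finite_P: "finite P"
  using card_P by (intro card_ge_0_finite) simp

lemma P_sub: "C \<in> P \<Longrightarrow> C \<subseteq> pairs {1..v}"
  using Union_P by blast

text \<open>The family lemma applied to the components: their union is the complement of
  \<open>S\<close>, so the deficit is the size of \<open>S\<close>.\<close>

lemma deficit:
  "real (card P) * (real v - 2) \<le> real (card S)"
  "real (card P) * (real v - 2) = real (card S) \<Longrightarrow>
    (\<exists>e \<in> pairs {1..v}. P = {{e}, pairs ({1..v} - e)}) \<or>
    (v = 2 * card P \<and> (\<forall>C\<in>P. \<exists>e. C = {e}))"
proof -
  have "real (card (pairs {1..v})) - real (card (\<Union>P)) = real (card S)" "card {1..v} = v"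
    using card_diff_pairs[OF S_sub] by (simp_all only: Union_P card_atLeastAtMost diff_Suc_1')
  note eqs = this
  note P_facts = finite_atLeastAtMost[of 1 v] finite_P card_P P_nonempty P_sub P_disjoint
  show "real (card P) * (real v - 2) \<le> real (card S)"
    unfolding eqs(1)[symmetric]
    by (rule disjoint_family_pairs_deficit(1)[where A = "{1..v}", unfolded eqs(2)]; fact P_facts)
  show "(\<exists>e \<in> pairs {1..v}. P = {{e}, pairs ({1..v} - e)}) \<or>
      (v = 2 * card P \<and> (\<forall>C\<in>P. \<exists>e. C = {e}))"
    if "real (card P) * (real v - 2) = real (card S)"
    by (rule disjoint_family_pairs_deficit(2)[where A = "{1..v}", unfolded eqs(2)];
        fact P_facts that[unfolded eqs(1)[symmetric]])
qed

lemma ratio_ge: "real v - 2 \<le> toughness_ratio (triangular_graph v) S"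
proof -
  have "real (card P) > 0" using card_P by simp
  then show ?thesis
    using deficit(1) unfolding toughness_ratio_def
    by (subst pos_le_divide_eq) (simp_all only: mult.commute)
qed

lemma ratio_eqD:
  assumes "toughness_ratio (triangular_graph v) S = real v - 2"
  shows "(\<exists>e \<in> verts (triangular_graph v). S = neighborhood (triangular_graph v) e)
    \<or> (even v \<and> (\<exists>I. maximum_independent_set (triangular_graph v) I
        \<and> S = verts (triangular_graph v) - I))"
proof -
  have "real (card P) * (real v - 2) = real (card S)"
  proof -
    have "real (card P) \<noteq> 0" using card_P by simp
    then have "real (card P) * (real (card S) / real (card P)) = real (card S)"
      by (metis nonzero_mult_div_cancel_left times_divide_eq_right)
    then show ?thesis using assms unfolding toughness_ratio_def by simp
  qed
  then consider e where "e \<in> pairs {1..v}" "P = {{e}, pairs ({1..v} - e)}"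
    | "v = 2 * card P" "\<forall>C\<in>P. \<exists>e. C = {e}"
    using deficit(2) by auto
  then show ?thesis
  proof cases
    case 1
    then have "pairs {1..v} - S = pairs {1..v} - neighborhood (triangular_graph v) e"
      using Union_P neighborhood_triangular_graph[OF 1(1)] by simp
    moreover have "neighborhood (triangular_graph v) e \<subseteq> pairs {1..v}"
      by (auto simp: neighborhood_def verts_triangular_graph_pairs)
    ultimately have "S = neighborhood (triangular_graph v) e"
      using S_sub by blast
    then show ?thesis using 1(1) verts_triangular_graph_pairs by blast
  next
    case 2
    define I where "I = pairs {1..v} - S"
    \<comment> \<open>All components are single pairs, so they correspond to the surviving pairs.
      Disjoint supports then make \<open>I\<close> a matching with \<open>v div 2\<close>
      members.\<close>
    have PI: "P = (\<lambda>e. {e}) ` I"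
      using 2(2) Union_P unfolding I_def[symmetric] by fastforce
    have "card I = card P" unfolding PI by (simp add: card_image)
    moreover have "independent_set (triangular_graph v) I"
    proof -
      have "e \<inter> f = {}" if "e \<in> I" "f \<in> I" "e \<noteq> f" for e f
        using that P_disjoint[of "{e}" "{f}"] PI by auto
      then show ?thesis by (auto simp: independent_set_triangular_graph I_def)
    qed
    moreover have "even v" "v div 2 = card P" using 2(1) by (metis dvd_triv_left, simp)
    ultimately have "maximum_independent_set (triangular_graph v) I"
      using maximum_independent_set_triangular_graph[of v I] by simp
    moreover have "S = verts (triangular_graph v) - I"
      using S_sub by (auto simp: I_def verts_triangular_graph_pairs)
    ultimately show ?thesis using \<open>even v\<close> by blast
  qed
qed

end

text \<open>What survives is the isolated vertex \<open>e\<close> and a copy of the triangular graph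
  on the other \<open>v - 2\<close> points. That makes two components, against
  \<open>2 * (v - 2)\<close> deleted vertices.\<close>

lemma neighborhood_tough:
  assumes v: "v \<ge> 4" and e: "e \<in> verts (triangular_graph v)"
  defines "S \<equiv> neighborhood (triangular_graph v) e"
  shows "disconnecting (triangular_graph v) S \<and> toughness_ratio (triangular_graph v) S = real v - 2"
proof -
  let ?H = "remove_verts (triangular_graph v) S" and ?D = "pairs ({1..v} - e)"
  have e': "e \<in> pairs {1..v}" using e by (simp add: verts_triangular_graph_pairs)
  then have ce: "card e = 2" "e \<subseteq> {1..v}" by (auto simp: pairs_def)
  have fe: "finite e" using ce(2) by (rule finite_subset) simp
  have W: "verts ?H = insert e ?D"
    using neighborhood_triangular_graph[OF e']
    by (simp add: S_def verts_remove_verts verts_triangular_graph_pairs)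
  have adj: "adjacent ?H x y \<longleftrightarrow> x \<in> insert e ?D \<and> y \<in> insert e ?D \<and> x \<noteq> y \<and> x \<inter> y \<noteq> {}" for x y
    using W by (auto simp: adjacent_remove_verts adjacent_triangular_graph_iff verts_remove_verts
        verts_triangular_graph_pairs)
  have conn_meet: "(adjacent ?H)\<^sup>*\<^sup>* x y" if "x \<in> ?D" "y \<in> ?D" "x \<inter> y \<noteq> {}" for x y
  proof (cases "x = y")
    case False
    then have "adjacent ?H x y" using that by (simp add: adj)
    then show ?thesis by (rule r_into_rtranclp)
  qed simp
  have conn: "(adjacent ?H)\<^sup>*\<^sup>* x y" if x: "x \<in> ?D" and y: "y \<in> ?D" for x y
  proof (cases "x \<inter> y = {}")
    case True
    have "x \<noteq> {}" "y \<noteq> {}" using x y by (auto simp: pairs_def)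
    then obtain a c where ac: "a \<in> x" "c \<in> y" by blast
    moreover have "a \<noteq> c" "x \<subseteq> {1..v} - e" "y \<subseteq> {1..v} - e"
      using x y ac True by (auto simp: pairs_def)
    \<comment> \<open>Disjoint pairs are joined through a pair that takes one point from
      each.\<close>
    ultimately have "{a, c} \<in> ?D" unfolding pairs_def by (simp add: subset_iff)
    then have "(adjacent ?H)\<^sup>*\<^sup>* x {a, c}" "(adjacent ?H)\<^sup>*\<^sup>* {a, c} y"
      using x y ac by (intro conn_meet; blast)+
    then show ?thesis by (rule rtranclp_trans)
  qed (use x y conn_meet in blast)
  have cD: "card ({1..v} - e) = v - 2"
    using ce fe by (subst card_Diff_subset) auto
  have D2: "2 * real (card ?D) = (real v - 2) * (real v - 3)"
    using real_card_pairs[of "{1..v} - e"] v unfolding cD by simp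
  \<comment> \<open>Here \<open>v \<ge> 4\<close> ensures that the second component is
    nonempty.\<close>
  have "(real v - 2) * (real v - 3) > 0" using v by (intro mult_pos_pos) simp_all
  then have "real (card ?D) > 0" using D2 by linarith
  then have Dne: "?D \<noteq> {}" by auto
  have eD: "e \<notin> ?D"
  proof
    assume "e \<in> ?D"
    then have "e = {}" by (auto simp: pairs_def)
    then show False using ce(1) by simp
  qed
  have H: "components ?H = {{e}, ?D}"
  proof (rule components_eqI)
    show "\<Union>{{e}, ?D} = verts ?H" using W by auto
    show "{} \<notin> {{e}, ?D}" using Dne by auto
    show "(adjacent ?H)\<^sup>*\<^sup>* x y" if "C \<in> {{e}, ?D}" "x \<in> C" "y \<in> C" for C x y
      using that conn by auto
    have "e \<inter> x = {}" if "x \<in> ?D" for x using that by (auto simp: pairs_def)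
    then show "y \<in> C" if "C \<in> {{e}, ?D}" "x \<in> C" "adjacent ?H x y" for C x y
      using that by (auto simp: adj)
  qed
  have "{e} \<noteq> ?D" using eD by blast
  then have cH: "card (components ?H) = 2" unfolding H by simp
  have "S \<subseteq> pairs {1..v}" by (auto simp: S_def neighborhood_def verts_triangular_graph_pairs)
  moreover have "pairs {1..v} - S = insert e ?D"
    using neighborhood_triangular_graph[OF e'] by (simp add: S_def)
  moreover have "card (insert e ?D) = card ?D + 1" using eD by (simp add: finite_pairs)
  ultimately have "real (card S) = real (card (pairs {1..v})) - (real (card ?D) + 1)"
    using card_diff_pairs[of S v] by simp
  then have "2 * real (card S) = 4 * (real v - 2)"
    using D2 card_pairs_atLeastAtMost[of v] by (simp add: algebra_simps)
  then show ?thesis using cH \<open>S \<subseteq> pairs {1..v}\<close>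
    by (simp add: disconnecting_def toughness_ratio_def verts_triangular_graph_pairs)
qed

text \<open>A perfect matching survives as \<open>v div 2\<close> isolated vertices, while
  \<open>v * (v - 1) / 2 - v / 2 = (v / 2) * (v - 2)\<close> vertices are deleted.\<close>

lemma matching_complement_tough:
  assumes v: "v \<ge> 4" "even v" and I: "maximum_independent_set (triangular_graph v) I"
  defines "S \<equiv> verts (triangular_graph v) - I"
  shows "disconnecting (triangular_graph v) S \<and> toughness_ratio (triangular_graph v) S = real v - 2"
proof -
  let ?H = "remove_verts (triangular_graph v) S"
  have ind: "independent_set (triangular_graph v) I" and cI: "card I = v div 2"
    using I maximum_independent_set_triangular_graph[OF v(2)] by auto
  then have sub: "I \<subseteq> pairs {1..v}" by (simp add: independent_set_triangular_graph)
  have S: "S \<subseteq> pairs {1..v}" "pairs {1..v} - S = I"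
    using sub by (auto simp: S_def verts_triangular_graph_pairs)
  have nadj: "\<not> adjacent ?H x y" for x y
    using ind S(2) by (auto simp: adjacent_remove_verts adjacent_triangular_graph_iff
        independent_set_triangular_graph)
  have "components ?H = (\<lambda>e. {e}) ` I"
    using nadj S(2) by (intro components_eqI) (auto simp: verts_remove_verts verts_triangular_graph_pairs)
  then have cH: "card (components ?H) = v div 2" by (simp add: card_image cI)
  have half: "real (v div 2) = real v / 2" using v(2) by (simp add: real_of_nat_div)
  have "2 * real (card S) = real v * (real v - 2)"
    using card_diff_pairs[OF S(1)] card_pairs_atLeastAtMost[of v] unfolding S(2) cI half
    by (simp add: algebra_simps)
  then have "real (card S) = real (v div 2) * (real v - 2)"
    unfolding half by simp
  \<comment> \<open>This makes \<open>S\<close> disconnecting and the denominator of the ratio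
    nonzero.\<close>
  moreover have "v div 2 \<ge> 2" using v(1) by simp
  ultimately show ?thesis using cH S(1)
    by (simp add: disconnecting_def toughness_ratio_def verts_triangular_graph_pairs)
qed

theorem theorem4p2:
  fixes v :: nat
  assumes "v \<ge> 4"
  shows "toughness (triangular_graph v) = real v - 2
    \<and> (\<forall>S. disconnecting (triangular_graph v) S
             \<and> toughness_ratio (triangular_graph v) S = real v - 2
           \<longleftrightarrow> (\<exists>e \<in> verts (triangular_graph v). S = neighborhood (triangular_graph v) e)
             \<or> (even v \<and> (\<exists>I. maximum_independent_set (triangular_graph v) I
                              \<and> S = verts (triangular_graph v) - I)))
    \<and> (even v \<longrightarrow> (\<forall>I. maximum_independent_set (triangular_graph v) I \<longrightarrow> card I = v div 2))"
proof (intro conjI allI impI iffI)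
  let ?R = "{toughness_ratio (triangular_graph v) S | S. disconnecting (triangular_graph v) S}"
  \<comment> \<open>\<open>Min\<close> is meaningful only on a finite set; the ratios come from
    subsets of a finite vertex set.\<close>
  have "?R \<subseteq> toughness_ratio (triangular_graph v) ` Pow (verts (triangular_graph v))"
    by (auto simp: disconnecting_def)
  then have "finite ?R"
    by (rule finite_subset) (simp add: verts_triangular_graph_pairs finite_pairs)
  \<comment> \<open>Any vertex would do: its neighborhood attains the value
    \<open>v - 2\<close>.\<close>
  moreover have "{1, 2} \<in> verts (triangular_graph v)"
    using assms by (auto simp: verts_triangular_graph)
  from neighborhood_tough[OF assms this] have "real v - 2 \<in> ?R"
    unfolding mem_Collect_eq by (intro exI conjI) (elim conjE, erule sym, elim conjE, assumption)
  moreover have "real v - 2 \<le> r" if "r \<in> ?R" for r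
    using that by (auto intro: triangular_disconnecting.ratio_ge triangular_disconnecting.intro)
  ultimately show "toughness (triangular_graph v) = real v - 2"
    unfolding toughness_def by (intro Min_eqI)
next
  fix S assume "disconnecting (triangular_graph v) S
    \<and> toughness_ratio (triangular_graph v) S = real v - 2"
  then show "(\<exists>e \<in> verts (triangular_graph v). S = neighborhood (triangular_graph v) e)
    \<or> (even v \<and> (\<exists>I. maximum_independent_set (triangular_graph v) I
        \<and> S = verts (triangular_graph v) - I))"
    by (elim conjE) (rule triangular_disconnecting.ratio_eqD[OF triangular_disconnecting.intro])
next
  fix S assume "(\<exists>e \<in> verts (triangular_graph v). S = neighborhood (triangular_graph v) e)
    \<or> (even v \<and> (\<exists>I. maximum_independent_set (triangular_graph v) I
        \<and> S = verts (triangular_graph v) - I))"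
  then have "disconnecting (triangular_graph v) S
    \<and> toughness_ratio (triangular_graph v) S = real v - 2"
    using neighborhood_tough[OF assms] matching_complement_tough[OF assms]
    by (elim disjE conjE exE bexE) simp_all
  then show "disconnecting (triangular_graph v) S"
    and "toughness_ratio (triangular_graph v) S = real v - 2" by auto
next
  fix I assume "even v" "maximum_independent_set (triangular_graph v) I"
  then show "card I = v div 2" by (simp add: maximum_independent_set_triangular_graph)
qed

end
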